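(* Let $H$ be a complex Hilbert space with $\dim H\ge 2$ and let $H_C$ be a complex Hilbert space. There do not exist a unitary operator $U$ on $H\otimes H\otimes H_C$ and normalized vectors $|e\rangle\in H$ and $|f\rangle,|g\rangle\in H_C$ such that for every normalized $|\phi\rangle\in H$ there is a complex number $c_\phi$ (depending on $\phi$) with $0<|c_\phi|\le 1$ and $$\langle g|_C\, U\big(|\phi\rangle\otimes|e\rangle\otimes|f\rangle\big)=c_\phi\,|\phi\rangle\otimes|\phi\rangle .$$ Equivalently, there do not exist such $U$, $|e\rangle$, $|f\rangle$, $|g\rangle$ such that for every normalized $|\phi\rangle\in H$ there are a complex number $c_\phi$ with $0<|c_\phi|\le 1$ and a vector $|\Phi_\phi\rangle\in H\otimes H\otimes |g\rangle^{\perp}$ with $$U\big(|\phi\rangle\otimes|e\rangle\otimes|f\rangle\big)=c_\phi\,|\phi\rangle\otimes|\phi\rangle\otimes|g\rangle+|\Phi_\phi\rangle .$$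
   Context: "Normalized" means of norm $1$. Tensor products are Hilbert space tensor products. For $|g\rangle\in H_C$, the map $\langle g|_C: H\otimes H\otimes H_C\to H\otimes H$ denotes $I_H\otimes I_H\otimes\langle g|$, i.e. the bounded linear map determined by $x\otimes y\otimes z\mapsto \langle g|z\rangle\, x\otimes y$ (inner product linear in the second argument). $|g\rangle^{\perp}\subseteq H_C$ is the orthogonal complement of the span of $|g\rangle$. (Interpretation: the third factor $H_C$ is an ancilla initialized to $|f\rangle$ and finally postselected, equivalently subjected to conjugated state preparation, on $|g\rangle$.) *)

theory Defs
  imports "HOL-Analysis.Analysis"
begin

section \<open>Complex Hilbert spaces\<close>

class cinner_space = ab_group_add +
  fixes scaleC :: "complex \<Rightarrow> 'a \<Rightarrow> 'a" (infixr "*\<^sub>C" 75)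
    and cinner :: "'a \<Rightarrow> 'a \<Rightarrow> complex"
  assumes scaleC_add_right: "a *\<^sub>C (x + y) = a *\<^sub>C x + a *\<^sub>C y"
    and scaleC_add_left: "(a + b) *\<^sub>C x = a *\<^sub>C x + b *\<^sub>C x"
    and scaleC_scaleC: "a *\<^sub>C b *\<^sub>C x = (a * b) *\<^sub>C x"
    and scaleC_one: "1 *\<^sub>C x = x"
    and cinner_commute: "cinner x y = cnj (cinner y x)"
    and cinner_add_right: "cinner x (y + z) = cinner x y + cinner x z"
    and cinner_scaleC_right: "cinner x (a *\<^sub>C y) = a * cinner x y"
    and cinner_ge_zero: "0 \<le> Re (cinner x x)"
    and cinner_eq_zero: "cinner x x = 0 \<Longrightarrow> x = 0"

class complex_inner = cinner_space + real_normed_vector +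
  assumes scaleR_scaleC: "r *\<^sub>R x = complex_of_real r *\<^sub>C x"
    and norm_eq_sqrt_cinner: "norm x = sqrt (Re (cinner x x))"

class chilbert_space = complex_inner + complete_space

text \<open>The inner product is antilinear in the first and linear in the second argument.\<close>

global_interpretation complex_vector: vector_space "scaleC :: complex \<Rightarrow> 'a \<Rightarrow> 'a::cinner_space"
  defines cdependent = complex_vector.dependent
    and cspan = complex_vector.span
  by unfold_locales (auto simp: scaleC_add_right scaleC_add_left scaleC_scaleC scaleC_one)

abbreviation clinear :: "('a::cinner_space \<Rightarrow> 'b::cinner_space) \<Rightarrow> bool" where
  "clinear \<equiv> Vector_Spaces.linear scaleC scaleC"

definition bounded_clinear :: "('a::complex_inner \<Rightarrow> 'b::complex_inner) \<Rightarrow> bool" where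
  "bounded_clinear f \<longleftrightarrow> clinear f \<and> (\<exists>B. \<forall>x. norm (f x) \<le> B * norm x)"

definition unitary :: "('a::complex_inner \<Rightarrow> 'a) \<Rightarrow> bool" where
  "unitary U \<longleftrightarrow> clinear U \<and> surj U \<and> (\<forall>x y. cinner (U x) (U y) = cinner x y)"

definition orthogonal_complement :: "'a::cinner_space set \<Rightarrow> 'a set" where
  "orthogonal_complement S = {x. \<forall>y\<in>S. cinner y x = 0}"

subsection \<open>Consequences of the axioms\<close>

lemma clinearI:
  assumes "\<And>x y. f (x + y) = f x + f y" "\<And>c x. f (c *\<^sub>C x) = c *\<^sub>C f x"
  shows "clinear f"
  unfolding Vector_Spaces.linear_def module_hom_def module_hom_axioms_def
  by (intro conjI allI assms complex_vector.vector_space_axioms complex_vector.module_axioms)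

lemma clinearD:
  assumes "clinear f"
  shows "f (x + y) = f x + f y" "f (c *\<^sub>C x) = c *\<^sub>C f x"
  using assms by (auto simp: Vector_Spaces.linear_def module_hom_def module_hom_axioms_def)

lemma cinner_zero_right [simp]: "cinner x (0::'a::cinner_space) = 0"
  using cinner_add_right[of x 0 0] by simp

lemma cinner_zero_left [simp]: "cinner (0::'a::cinner_space) x = 0"
  using cinner_commute[of 0 x] by simp

lemma cinner_add_left: "cinner (x + y) (z::'a::cinner_space) = cinner x z + cinner y z"
  using cinner_commute[of "x + y" z] cinner_commute[of x z] cinner_commute[of y z]
  by (simp add: cinner_add_right)

lemma cinner_scaleC_left: "cinner (a *\<^sub>C x) (y::'a::cinner_space) = cnj a * cinner x y"
  using cinner_commute[of "a *\<^sub>C x" y] cinner_commute[of x y] by (simp add: cinner_scaleC_right)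

lemma cinner_minus_right: "cinner x (- y::'a::cinner_space) = - cinner x y"
  using cinner_add_right[of x y "- y"] by (simp add: eq_neg_iff_add_eq_0 add.commute)

lemma cinner_minus_left: "cinner (- x) (y::'a::cinner_space) = - cinner x y"
  using cinner_add_left[of x "- x" y] by (simp add: eq_neg_iff_add_eq_0 add.commute)

lemma cinner_diff_right: "cinner x (y - z::'a::cinner_space) = cinner x y - cinner x z"
  using cinner_add_right[of x y "- z"] by (simp add: cinner_minus_right)

lemma cinner_diff_left: "cinner (x - y) (z::'a::cinner_space) = cinner x z - cinner y z"
  using cinner_add_left[of x "- y" z] by (simp add: cinner_minus_left)

lemmas cinner_simps = cinner_add_left cinner_add_right cinner_diff_left cinner_diff_right
  cinner_scaleC_left cinner_scaleC_right cinner_minus_left cinner_minus_right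

lemma cinner_sum_right: "cinner x (sum f A :: 'a::cinner_space) = (\<Sum>i\<in>A. cinner x (f i))"
  by (induction A rule: infinite_finite_induct) (auto simp: cinner_add_right)

lemma cinner_sum_left: "cinner (sum f A :: 'a::cinner_space) x = (\<Sum>i\<in>A. cinner (f i) x)"
  by (induction A rule: infinite_finite_induct) (auto simp: cinner_add_left)

lemma cinner_self: "cinner x (x::'a::cinner_space) = complex_of_real (Re (cinner x x))"
proof -
  have "Im (cinner x x) = 0"
    using arg_cong[OF cinner_commute[of x x], of Im] by simp
  then show ?thesis by (simp add: complex_eq_iff)
qed

lemma Cauchy_Schwarz_cinner_sq:
  fixes x y :: "'a::cinner_space"
  shows "(cmod (cinner x y))\<^sup>2 \<le> Re (cinner x x) * Re (cinner y y)"
proof (cases "y = 0")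
  case False
  define s where "s = Re (cinner y y)"
  have s: "cinner y y = of_real s" using cinner_self[of y] by (simp add: s_def)
  have "s > 0"
    using cinner_ge_zero[of y] cinner_eq_zero[of y] False s unfolding s_def
    by (metis less_eq_real_def of_real_0)
  define a where "a = cinner y x / s"
  define r where "r = Re (cinner x x)"
  have r: "cinner x x = of_real r" using cinner_self[of x] by (simp add: r_def)
  have xy: "cinner x y = cnj (cinner y x)" by (rule cinner_commute)
  have e: "cinner y x * cnj (cinner y x) = of_real ((cmod (cinner y x))\<^sup>2)"
    by (rule complex_norm_square[symmetric])
  have "cinner (x - a *\<^sub>C y) (x - a *\<^sub>C y) = of_real r - of_real ((cmod (cinner y x))\<^sup>2 / s)"
    using \<open>s > 0\<close> e
    by (simp add: cinner_simps r s xy a_def field_simps power2_eq_square)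
  then have "0 \<le> r - (cmod (cinner y x))\<^sup>2 / s"
    using cinner_ge_zero[of "x - a *\<^sub>C y"] by (metis Re_complex_of_real of_real_diff)
  then show ?thesis
    using \<open>s > 0\<close> by (simp add: xy flip: r_def s_def) (simp add: field_simps)
qed auto

lemma sqrt_cinner_triangle:
  fixes x y :: "'a::cinner_space"
  shows "sqrt (Re (cinner (x + y) (x + y))) \<le> sqrt (Re (cinner x x)) + sqrt (Re (cinner y y))"
proof -
  have "cmod (cinner x y) \<le> sqrt (Re (cinner x x)) * sqrt (Re (cinner y y))"
    using real_le_rsqrt[OF Cauchy_Schwarz_cinner_sq[of x y]] by (simp add: real_sqrt_mult)
  then have "Re (cinner x y) \<le> sqrt (Re (cinner x x)) * sqrt (Re (cinner y y))"
    using complex_Re_le_cmod order_trans by blast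
  moreover have "Re (cinner y x) = Re (cinner x y)"
    using arg_cong[OF cinner_commute[of y x], of Re] by simp
  ultimately have "Re (cinner (x + y) (x + y))
      \<le> (sqrt (Re (cinner x x)) + sqrt (Re (cinner y y)))\<^sup>2"
    by (simp add: cinner_simps power2_sum cinner_ge_zero)
  then show ?thesis
    by (intro real_le_lsqrt add_nonneg_nonneg real_sqrt_ge_zero cinner_ge_zero)
qed

lemma sqrt_cinner_scaleC:
  "sqrt (Re (cinner (a *\<^sub>C x) (a *\<^sub>C x))) = cmod a * sqrt (Re (cinner x (x::'a::cinner_space)))"
proof -
  have "cinner (a *\<^sub>C x) (a *\<^sub>C x) = (a * cnj a) * of_real (Re (cinner x x))"
    using cinner_self[of x] by (simp add: cinner_simps)
  also have "\<dots> = of_real ((cmod a)\<^sup>2 * Re (cinner x x))"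
    by (simp flip: complex_norm_square)
  finally show ?thesis
    by (simp add: real_sqrt_mult)
qed

lemma cinner_norm_sq: "cinner x x = complex_of_real ((norm (x::'a::complex_inner))\<^sup>2)"
  using cinner_self[of x] by (simp add: norm_eq_sqrt_cinner cinner_ge_zero)

lemma norm_scaleC: "norm (a *\<^sub>C x) = cmod a * norm (x::'a::complex_inner)"
  by (simp add: norm_eq_sqrt_cinner sqrt_cinner_scaleC)

lemma Cauchy_Schwarz_cinner: "cmod (cinner x y) \<le> norm x * norm (y::'a::complex_inner)"
  using real_le_rsqrt[OF Cauchy_Schwarz_cinner_sq[of x y]]
  by (simp add: norm_eq_sqrt_cinner real_sqrt_mult)

lemma bounded_bilinear_cinner: "bounded_bilinear (cinner :: 'a::complex_inner \<Rightarrow> 'a \<Rightarrow> complex)"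
proof
  show "\<exists>K. \<forall>a b::'a. norm (cinner a b) \<le> norm a * norm b * K"
    using Cauchy_Schwarz_cinner by (intro exI[of _ 1]) auto
qed (auto simp: cinner_simps scaleR_scaleC scaleR_conv_of_real)

lemma bounded_clinear_bounded_linear:
  assumes "bounded_clinear f"
  shows "bounded_linear f"
proof -
  obtain B where "clinear f" "\<And>x. norm (f x) \<le> B * norm x"
    using assms unfolding bounded_clinear_def by blast
  then show ?thesis
    by (intro bounded_linear_intro[of f B]) (auto simp: clinearD scaleR_scaleC mult.commute)
qed

lemma bounded_linear_scaleC: "bounded_linear (\<lambda>x::'a::complex_inner. a *\<^sub>C x)"
  by (rule bounded_linear_intro[of _ "cmod a"])
    (auto simp: norm_scaleC scaleC_add_right scaleR_scaleC scaleC_scaleC mult.commute)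

lemma gram_schmidt:
  fixes A :: "'a::complex_inner set"
  assumes "finite A"
  shows "\<exists>E. finite E \<and> (\<forall>e\<in>E. \<forall>e'\<in>E. cinner e e' = (if e = e' then 1 else 0)) \<and>
    (\<forall>a\<in>A. a = (\<Sum>e\<in>E. cinner e a *\<^sub>C e))"
  using assms
proof (induction A rule: finite_induct)
  case empty
  then show ?case by (intro exI[of _ "{}"]) auto
next
  case (insert a A)
  then obtain E where E: "finite E" "\<And>e e'. e \<in> E \<Longrightarrow> e' \<in> E \<Longrightarrow> cinner e e' = (if e = e' then 1 else 0)"
    "\<And>b. b \<in> A \<Longrightarrow> b = (\<Sum>e\<in>E. cinner e b *\<^sub>C e)" by metis
  define p where "p = (\<Sum>e\<in>E. cinner e a *\<^sub>C e)"
  define r where "r = a - p"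
  show ?case
  proof (cases "r = 0")
    case True
    then show ?thesis using E unfolding r_def p_def by (intro exI[of _ E]) auto
  next
    case False
    have er: "cinner e r = 0" if "e \<in> E" for e
    proof -
      have "cinner e p = (\<Sum>e'\<in>E. if e = e' then cinner e' a else 0)"
        unfolding p_def cinner_sum_right
        by (intro sum.cong) (auto simp: cinner_scaleC_right E that)
      also have "\<dots> = cinner e a" using E(1) that by simp
      finally show ?thesis by (simp add: r_def cinner_simps)
    qed
    have re: "cinner r e = 0" if "e \<in> E" for e
      using er[OF that] cinner_commute[of r e] by simp
    define u where "u = complex_of_real (1 / norm r) *\<^sub>C r"
    have nr: "norm r \<noteq> 0" using False by simp
    have uu: "cinner u u = 1"
      using nr by (simp add: u_def cinner_norm_sq norm_scaleC norm_divide)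
    have ue: "cinner u e = 0" "cinner e u = 0" if "e \<in> E" for e
      using er[OF that] re[OF that] by (auto simp: u_def cinner_simps)
    have unE: "u \<notin> E" using ue uu by force
    have exp: "b = (\<Sum>e\<in>insert u E. cinner e b *\<^sub>C e)" if "b \<in> A" for b
    proof -
      have "cinner u b = cinner u (\<Sum>e\<in>E. cinner e b *\<^sub>C e)" using E(3)[OF that] by simp
      also have "\<dots> = 0" by (simp add: cinner_sum_right cinner_simps ue)
      finally show ?thesis using E(1,3) that unE by simp
    qed
    have "cinner r p = 0" by (simp add: p_def cinner_sum_right cinner_simps re)
    then have "cinner r a = of_real ((norm r)\<^sup>2)"
      using cinner_add_right[of r r p] cinner_norm_sq[of r] by (simp add: r_def)
    then have "cinner u a *\<^sub>C u = r"
      using nr by (simp add: u_def cinner_simps scaleC_scaleC power2_eq_square scaleC_one)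
    then have "a = (\<Sum>e\<in>insert u E. cinner e a *\<^sub>C e)"
      using E(1) unE by (simp add: r_def flip: p_def)
    then show ?thesis
      using E(1,2) exp uu ue unE
      by (intro exI[of _ "insert u E"]) auto
  qed
qed

section \<open>The algebraic tensor product\<close>

text \<open>The list of all \<open>(c\<^sub>i, a\<^sub>i, b\<^sub>i)\<close> stands for the formal sum of the \<open>c\<^sub>i a\<^sub>i \<otimes> b\<^sub>i\<close>, and
  \<open>fs_inner\<close> extends \<open>(a \<otimes> b | a' \<otimes> b') = (a | a') (b | b')\<close> sesquilinearly. The form is positive
  semidefinite (\<open>fs_inner_ge_zero\<close> below); the algebraic tensor product is the quotient by
  its radical.\<close>

definition fs_inner ::
    "(complex \<times> 'a::complex_inner \<times> 'b::complex_inner) list \<Rightarrow> (complex \<times> 'a \<times> 'b) list \<Rightarrow> complex" where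
  "fs_inner F G =
    (\<Sum>(c, a, b)\<leftarrow>F. \<Sum>(c', a', b')\<leftarrow>G. cnj c * c' * cinner a a' * cinner b b')"

quotient_type (overloaded) ('a, 'b) alg_tensor = "(complex \<times> 'a::complex_inner \<times> 'b::complex_inner) list" /
  "\<lambda>F G. \<forall>K. fs_inner K F = fs_inner K G"
  by (rule equivpI) (auto simp: reflp_def symp_def transp_def)

lemma fs_inner_Nil [simp]: "fs_inner [] G = 0" "fs_inner F [] = 0"
  by (auto simp: fs_inner_def case_prod_unfold)

lemma fs_inner_append_left: "fs_inner (F @ F') G = fs_inner F G + fs_inner F' G"
  by (simp add: fs_inner_def)

lemma fs_inner_append_right: "fs_inner F (G @ G') = fs_inner F G + fs_inner F G'"
  by (induction F) (auto simp: fs_inner_def)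

lemma fs_inner_single:
  "fs_inner [(c, a, b)] [(c', a', b')] = cnj c * c' * cinner a a' * cinner b b'"
  by (simp add: fs_inner_def)

lemma fs_inner_commute: "fs_inner F G = cnj (fs_inner G F)"
proof -
  have s: "fs_inner [s] [t] = cnj (fs_inner [t] [s])" for s t :: "complex \<times> 'a \<times> 'b"
    by (cases s; cases t) (simp add: fs_inner_single, metis cinner_commute)
  have l: "fs_inner [s] G = cnj (fs_inner G [s])" for s
  proof (induction G)
    case (Cons t G)
    then show ?case
      using fs_inner_append_left[of "[t]" G "[s]"] fs_inner_append_right[of "[s]" "[t]" G] s[of s t]
      by simp
  qed simp
  show ?thesis
  proof (induction F)
    case (Cons t F)
    then show ?case
      using fs_inner_append_left[of "[t]" F G] fs_inner_append_right[of G "[t]" F] l[of t]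
      by simp
  qed simp
qed

definition fs_scale ::
    "complex \<Rightarrow> (complex \<times> 'a::complex_inner \<times> 'b::complex_inner) list \<Rightarrow> (complex \<times> 'a \<times> 'b) list" where
  "fs_scale k F = map (\<lambda>(c, a, b). (k * c, a, b)) F"

lemma fs_inner_scale_right: "fs_inner F (fs_scale k G) = k * fs_inner F G"
proof (induction G)
  case (Cons t G)
  have "fs_inner F (fs_scale k [t]) = k * fs_inner F [t]"
    by (cases t, induction F) (auto simp: fs_inner_def fs_scale_def algebra_simps)
  then show ?case
    using Cons fs_inner_append_right[of F "[t]" G]
      fs_inner_append_right[of F "fs_scale k [t]" "fs_scale k G"]
    by (simp add: fs_scale_def algebra_simps)
qed (simp add: fs_scale_def)

lemma fs_inner_scale_left: "fs_inner (fs_scale k F) G = cnj k * fs_inner F G"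
  by (subst (1 2) fs_inner_commute) (simp add: fs_inner_scale_right)

definition fs_contract1 ::
    "'a \<Rightarrow> (complex \<times> 'a::complex_inner \<times> 'b::complex_inner) list \<Rightarrow> 'b" where
  "fs_contract1 x F = (\<Sum>(c, a, b)\<leftarrow>F. (c * cinner x a) *\<^sub>C b)"

definition fs_contract2 ::
    "'b \<Rightarrow> (complex \<times> 'a::complex_inner \<times> 'b::complex_inner) list \<Rightarrow> 'a" where
  "fs_contract2 y F = (\<Sum>(c, a, b)\<leftarrow>F. (c * cinner y b) *\<^sub>C a)"

lemma fs_inner_contract1:
  "fs_inner [(c, a, b)] G = cnj c * cinner b (fs_contract1 a G)"
  by (induction G)
    (auto simp: fs_inner_def fs_contract1_def cinner_simps algebra_simps)

lemma fs_contract1_sum: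
  "fs_contract1 (\<Sum>e\<in>E. k e *\<^sub>C e) G = (\<Sum>e\<in>E. cnj (k e) *\<^sub>C fs_contract1 e G)"
proof (induction G)
  case Nil
  then show ?case by (simp add: fs_contract1_def complex_vector.scale_zero_right)
next
  case (Cons t G)
  obtain c a b where t: "t = (c, a, b)" by (cases t)
  have c: "fs_contract1 x (t # G) = (c * cinner x a) *\<^sub>C b + fs_contract1 x G" for x
    by (simp add: fs_contract1_def t)
  have "(c * cinner (\<Sum>e\<in>E. k e *\<^sub>C e) a) *\<^sub>C b = (\<Sum>e\<in>E. cnj (k e) *\<^sub>C (c * cinner e a) *\<^sub>C b)"
    by (simp add: cinner_sum_left cinner_simps sum_distrib_left complex_vector.scale_sum_left
        scaleC_scaleC algebra_simps)
  then show ?case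
    by (simp add: c Cons scaleC_add_right sum.distrib)
qed

lemma fs_inner_expand:
  assumes "\<forall>(c, a, b)\<in>set F. a = (\<Sum>e\<in>E. cinner e a *\<^sub>C e)"
  shows "fs_inner F G = (\<Sum>e\<in>E. cinner (fs_contract1 e F) (fs_contract1 e G))"
  using assms
proof (induction F)
  case Nil
  then show ?case by (simp add: fs_contract1_def)
next
  case (Cons t F)
  obtain c a b where t: "t = (c, a, b)" by (cases t)
  have a: "a = (\<Sum>e\<in>E. cinner e a *\<^sub>C e)" using Cons.prems t by simp
  have c: "fs_contract1 x (t # F) = (c * cinner x a) *\<^sub>C b + fs_contract1 x F" for x
    by (simp add: fs_contract1_def t)
  have "fs_inner [t] G = cnj c * cinner b (fs_contract1 a G)"
    by (simp add: t fs_inner_contract1)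
  also have "fs_contract1 a G = (\<Sum>e\<in>E. cnj (cinner e a) *\<^sub>C fs_contract1 e G)"
    using fs_contract1_sum[of "\<lambda>e. cinner e a" E G] a by simp
  also have "cnj c * cinner b \<dots> = (\<Sum>e\<in>E. cinner ((c * cinner e a) *\<^sub>C b) (fs_contract1 e G))"
    by (simp add: cinner_sum_right cinner_simps sum_distrib_left algebra_simps)
  finally show ?case
    using Cons fs_inner_append_left[of "[t]" F G]
    by (simp add: c cinner_add_left sum.distrib)
qed

lemma fs_orthonormal:
  fixes F :: "(complex \<times> 'a::complex_inner \<times> 'b::complex_inner) list"
  shows "\<exists>E. finite E \<and> (\<forall>e\<in>E. \<forall>e'\<in>E. cinner e e' = (if e = e' then 1 else 0)) \<and>
    (\<forall>(c, a, b)\<in>set F. a = (\<Sum>e\<in>E. cinner e a *\<^sub>C e))"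
  using gram_schmidt[of "(fst \<circ> snd) ` set F"] by (simp add: case_prod_unfold)

lemma fs_inner_self:
  assumes "\<forall>(c, a, b)\<in>set F. a = (\<Sum>e\<in>E. cinner e a *\<^sub>C e)"
  shows "fs_inner F F = of_real (\<Sum>e\<in>E. (norm (fs_contract1 e F))\<^sup>2)"
  using fs_inner_expand[OF assms, of F] by (simp add: cinner_norm_sq)

lemma fs_inner_ge_zero: "0 \<le> Re (fs_inner F F)"
proof -
  obtain E where E: "\<forall>(c, a, b)\<in>set F. a = (\<Sum>e\<in>E. cinner e a *\<^sub>C e)"
    using fs_orthonormal[of F] by blast
  from fs_inner_self[OF E] show ?thesis by (simp add: sum_nonneg)
qed

lemma fs_inner_eq_zero:
  assumes "fs_inner F F = 0"
  shows "fs_inner K F = 0"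
proof -
  obtain E where E: "finite E" "\<forall>(c, a, b)\<in>set F. a = (\<Sum>e\<in>E. cinner e a *\<^sub>C e)"
    using fs_orthonormal[of F] by blast
  have "(\<Sum>e\<in>E. (norm (fs_contract1 e F))\<^sup>2) = 0"
    using fs_inner_self[OF E(2)] assms by (metis of_real_eq_0_iff)
  then have "\<forall>e\<in>E. fs_contract1 e F = 0"
    using E(1) by (simp add: sum_nonneg_eq_0_iff)
  then have "fs_inner F K = 0"
    using fs_inner_expand[OF E(2), of K] by simp
  then show ?thesis using fs_inner_commute[of K F] by simp
qed

lemma fs_contract2_inner: "cinner x (fs_contract2 y F) = fs_inner [(1, x, y)] F"
  by (induction F)
    (auto simp: fs_inner_def fs_contract2_def cinner_simps algebra_simps)

lemma fs_contract2_norm: "norm (fs_contract2 y F) \<le> norm y * sqrt (Re (fs_inner F F))"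
proof -
  obtain E where E: "finite E" "\<forall>e\<in>E. \<forall>e'\<in>E. cinner e e' = (if e = e' then 1 else 0)"
    "\<forall>(c, a, b)\<in>set F. a = (\<Sum>e\<in>E. cinner e a *\<^sub>C e)"
    using fs_orthonormal[of F] by blast
  have s: "fs_contract2 y F = (\<Sum>e\<in>E. cinner y (fs_contract1 e F) *\<^sub>C e)"
    using E(3)
  proof (induction F)
    case Nil
    then show ?case by (simp add: fs_contract1_def fs_contract2_def complex_vector.scale_zero_left)
  next
    case (Cons t F)
    obtain c a b where t: "t = (c, a, b)" by (cases t)
    have a: "a = (\<Sum>e\<in>E. cinner e a *\<^sub>C e)" using Cons.prems t by simp
    have c1: "fs_contract1 x (t # F) = (c * cinner x a) *\<^sub>C b + fs_contract1 x F" for x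
      by (simp add: fs_contract1_def t)
    have c2: "fs_contract2 y (t # F) = (c * cinner y b) *\<^sub>C a + fs_contract2 y F"
      by (simp add: fs_contract2_def t)
    have "(c * cinner y b) *\<^sub>C a = (c * cinner y b) *\<^sub>C (\<Sum>e\<in>E. cinner e a *\<^sub>C e)"
      using a by simp
    also have "\<dots> = (\<Sum>e\<in>E. cinner y ((c * cinner e a) *\<^sub>C b) *\<^sub>C e)"
      by (simp add: complex_vector.scale_sum_right scaleC_scaleC cinner_simps algebra_simps)
    finally show ?case
      using Cons by (simp add: c1 c2 cinner_add_right scaleC_add_left sum.distrib)
  qed
  have "cinner (fs_contract2 y F) (fs_contract2 y F) =
      (\<Sum>e\<in>E. \<Sum>e'\<in>E. cnj (cinner y (fs_contract1 e F)) * cinner y (fs_contract1 e' F) * cinner e e')"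
    unfolding s
    by (subst cinner_sum_left) (simp add: cinner_sum_right cinner_simps sum_distrib_left algebra_simps)
  also have "\<dots> = (\<Sum>e\<in>E. \<Sum>e'\<in>E.
      if e = e' then cnj (cinner y (fs_contract1 e F)) * cinner y (fs_contract1 e' F) else 0)"
    by (intro sum.cong refl) (auto simp: E)
  also have "\<dots> = (\<Sum>e\<in>E. of_real ((cmod (cinner y (fs_contract1 e F)))\<^sup>2))"
    using E(1) by (intro sum.cong refl) (simp add: complex_norm_square mult.commute del: of_real_power)
  finally have "(norm (fs_contract2 y F))\<^sup>2 = (\<Sum>e\<in>E. (cmod (cinner y (fs_contract1 e F)))\<^sup>2)"
    unfolding cinner_norm_sq by (metis of_real_eq_iff of_real_sum)
  also have "\<dots> \<le> (\<Sum>e\<in>E. (norm y)\<^sup>2 * (norm (fs_contract1 e F))\<^sup>2)"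
    by (intro sum_mono) (metis Cauchy_Schwarz_cinner norm_ge_zero power_mono power_mult_distrib)
  also have "\<dots> = (norm y)\<^sup>2 * Re (fs_inner F F)"
    using fs_inner_self[OF E(3)] by (simp add: sum_distrib_left)
  finally show ?thesis
    using real_le_rsqrt by (fastforce simp: real_sqrt_mult)
qed

instantiation alg_tensor :: (complex_inner, complex_inner) cinner_space
begin

lift_definition zero_alg_tensor :: "('a, 'b) alg_tensor" is "[]" .

lift_definition plus_alg_tensor :: "('a, 'b) alg_tensor \<Rightarrow> ('a, 'b) alg_tensor \<Rightarrow> ('a, 'b) alg_tensor"
  is "(@)" by (simp add: fs_inner_append_right)

lift_definition scaleC_alg_tensor :: "complex \<Rightarrow> ('a, 'b) alg_tensor \<Rightarrow> ('a, 'b) alg_tensor"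
  is fs_scale by (simp add: fs_inner_scale_right)

lift_definition cinner_alg_tensor :: "('a, 'b) alg_tensor \<Rightarrow> ('a, 'b) alg_tensor \<Rightarrow> complex"
  is fs_inner by (metis fs_inner_commute)

definition "uminus_alg_tensor (x :: ('a, 'b) alg_tensor) = (- 1) *\<^sub>C x"
definition "minus_alg_tensor (x :: ('a, 'b) alg_tensor) y = x + - y"
instance
proof
  fix x y z :: "('a, 'b) alg_tensor" and a b :: complex
  show "x + y + z = x + (y + z)" by transfer simp
  show "x + y = y + x" by transfer (simp add: fs_inner_append_right)
  show "0 + x = x" by transfer simp
  show "- x + x = 0" unfolding uminus_alg_tensor_def
    by transfer (simp add: fs_inner_append_right fs_inner_scale_right)
  show "x - y = x + - y" by (simp add: minus_alg_tensor_def)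
  show "a *\<^sub>C (x + y) = a *\<^sub>C x + a *\<^sub>C y"
    by transfer (simp add: fs_inner_append_right fs_inner_scale_right algebra_simps)
  show "(a + b) *\<^sub>C x = a *\<^sub>C x + b *\<^sub>C x"
    by transfer (simp add: fs_inner_append_right fs_inner_scale_right algebra_simps)
  show "a *\<^sub>C b *\<^sub>C x = (a * b) *\<^sub>C x"
    by transfer (simp add: fs_inner_scale_right algebra_simps)
  show "1 *\<^sub>C x = x" by transfer (simp add: fs_inner_scale_right)
  show "cinner x y = cnj (cinner y x)" by transfer (rule fs_inner_commute)
  show "cinner x (y + z) = cinner x y + cinner x z" by transfer (rule fs_inner_append_right)
  show "cinner x (a *\<^sub>C y) = a * cinner x y" by transfer (rule fs_inner_scale_right)
  show "0 \<le> Re (cinner x x)" by transfer (rule fs_inner_ge_zero)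
  show "cinner x x = 0 \<Longrightarrow> x = 0" by transfer (simp add: fs_inner_eq_zero)
qed

end

instantiation alg_tensor :: (complex_inner, complex_inner) complex_inner
begin

definition "scaleR_alg_tensor r (x :: ('a, 'b) alg_tensor) = complex_of_real r *\<^sub>C x"
definition "norm_alg_tensor (x :: ('a, 'b) alg_tensor) = sqrt (Re (cinner x x))"
definition "sgn_alg_tensor (x :: ('a, 'b) alg_tensor) = inverse (norm x) *\<^sub>R x"
definition "dist_alg_tensor (x :: ('a, 'b) alg_tensor) y = norm (x - y)"
definition "uniformity_alg_tensor =
  (INF e\<in>{0 <..}. principal {(x :: ('a, 'b) alg_tensor, y). dist x y < e})"
definition "open_alg_tensor (S :: ('a, 'b) alg_tensor set) =
  (\<forall>x\<in>S. \<forall>\<^sub>F (x', y) in uniformity. x' = x \<longrightarrow> y \<in> S)"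

instance
proof
  fix x y :: "('a, 'b) alg_tensor" and a b :: real
  show "a *\<^sub>R (x + y) = a *\<^sub>R x + a *\<^sub>R y" "(a + b) *\<^sub>R x = a *\<^sub>R x + b *\<^sub>R x"
    "a *\<^sub>R b *\<^sub>R x = (a * b) *\<^sub>R x" "1 *\<^sub>R x = x" "a *\<^sub>R x = complex_of_real a *\<^sub>C x"
    by (auto simp: scaleR_alg_tensor_def scaleC_add_right scaleC_add_left scaleC_scaleC scaleC_one)
  show "norm x = 0 \<longleftrightarrow> x = 0"
    using cinner_self[of x] cinner_eq_zero[of x] by (auto simp: norm_alg_tensor_def)
  show "norm (x + y) \<le> norm x + norm y"
    unfolding norm_alg_tensor_def by (rule sqrt_cinner_triangle)
  show "norm (a *\<^sub>R x) = \<bar>a\<bar> * norm x"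
    by (simp add: norm_alg_tensor_def scaleR_alg_tensor_def sqrt_cinner_scaleC)
qed (simp_all add: sgn_alg_tensor_def dist_alg_tensor_def uniformity_alg_tensor_def
    open_alg_tensor_def norm_alg_tensor_def)

end

section \<open>Completion\<close>

text \<open>Cauchy sequences modulo null sequences, with \<open>(X | Y) = lim (X\<^sub>n | Y\<^sub>n)\<close>.\<close>

definition cauchy_eq :: "(nat \<Rightarrow> 'a::complex_inner) \<Rightarrow> (nat \<Rightarrow> 'a) \<Rightarrow> bool" where
  "cauchy_eq X Y \<longleftrightarrow> Cauchy X \<and> Cauchy Y \<and> (\<lambda>n. X n - Y n) \<longlonglongrightarrow> 0"

quotient_type (overloaded) 'a completion = "nat \<Rightarrow> 'a::complex_inner" / partial: cauchy_eq
proof (rule part_equivpI)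
  show "\<exists>X. cauchy_eq X (X :: nat \<Rightarrow> 'a)"
    by (intro exI[of _ "\<lambda>_. 0"]) (simp add: cauchy_eq_def convergent_Cauchy convergent_const)
  show "symp (cauchy_eq :: (nat \<Rightarrow> 'a) \<Rightarrow> _)"
  proof (rule sympI)
    fix X Y :: "nat \<Rightarrow> 'a"
    assume "cauchy_eq X Y"
    then show "cauchy_eq Y X"
      unfolding cauchy_eq_def using tendsto_minus[of "\<lambda>n. X n - Y n" 0] by simp
  qed
  show "transp (cauchy_eq :: (nat \<Rightarrow> 'a) \<Rightarrow> _)"
  proof (rule transpI)
    fix X Y Z :: "nat \<Rightarrow> 'a"
    assume "cauchy_eq X Y" "cauchy_eq Y Z"
    then show "cauchy_eq X Z"
      unfolding cauchy_eq_def using tendsto_add[of "\<lambda>n. X n - Y n" 0 _ "\<lambda>n. Y n - Z n" 0] by simp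
  qed
qed

lemma cauchy_eq_refl: "cauchy_eq X X \<longleftrightarrow> Cauchy X"
  by (simp add: cauchy_eq_def)

lemma Cauchy_plus:
  fixes X Y :: "nat \<Rightarrow> 'a::real_normed_vector"
  assumes "Cauchy X" "Cauchy Y"
  shows "Cauchy (\<lambda>n. X n + Y n)"
proof (rule CauchyI)
  fix e :: real
  assume "0 < e"
  then have "0 < e / 2" by simp
  obtain M where M: "\<forall>m\<ge>M. \<forall>n\<ge>M. norm (X m - X n) < e / 2"
    using CauchyD[OF assms(1) \<open>0 < e / 2\<close>] by blast
  obtain N where N: "\<forall>m\<ge>N. \<forall>n\<ge>N. norm (Y m - Y n) < e / 2"
    using CauchyD[OF assms(2) \<open>0 < e / 2\<close>] by blast
  have "norm (X m + Y m - (X n + Y n)) < e" if "m \<ge> max M N" "n \<ge> max M N" for m n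
  proof -
    have "norm (X m - X n) < e / 2" "norm (Y m - Y n) < e / 2"
      using M N that by auto
    then show ?thesis
      using norm_triangle_lt[of "X m - X n" "Y m - Y n" e] by (simp add: add_diff_add)
  qed
  then show "\<exists>M. \<forall>m\<ge>M. \<forall>n\<ge>M. norm (X m + Y m - (X n + Y n)) < e" by blast
qed

lemma Cauchy_cinner:
  fixes X Y :: "nat \<Rightarrow> 'a::complex_inner"
  assumes "Cauchy X" "Cauchy Y"
  shows "Cauchy (\<lambda>n. cinner (X n) (Y n))"
proof (rule CauchyI)
  fix e :: real
  assume "0 < e"
  obtain A where A: "A > 0" "\<And>n. norm (X n) \<le> A"
    using Cauchy_Bseq[OF assms(1)] unfolding Bseq_def by blast
  obtain B where B: "B > 0" "\<And>n. norm (Y n) \<le> B"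
    using Cauchy_Bseq[OF assms(2)] unfolding Bseq_def by blast
  obtain M where M: "\<And>m n. m \<ge> M \<Longrightarrow> n \<ge> M \<Longrightarrow> norm (X m - X n) < e / (2 * B)"
    using CauchyD[OF assms(1), of "e / (2 * B)"] \<open>0 < e\<close> B(1) by auto
  obtain N where N: "\<And>m n. m \<ge> N \<Longrightarrow> n \<ge> N \<Longrightarrow> norm (Y m - Y n) < e / (2 * A)"
    using CauchyD[OF assms(2), of "e / (2 * A)"] \<open>0 < e\<close> A(1) by auto
  have "norm (cinner (X m) (Y m) - cinner (X n) (Y n)) < e"
    if "m \<ge> max M N" "n \<ge> max M N" for m n
  proof -
    have "cinner (X m) (Y m) - cinner (X n) (Y n)
        = cinner (X m - X n) (Y m) + cinner (X n) (Y m - Y n)"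
      by (simp add: cinner_simps)
    also have "norm \<dots> \<le> norm (X m - X n) * norm (Y m) + norm (X n) * norm (Y m - Y n)"
      by (intro norm_triangle_le add_mono Cauchy_Schwarz_cinner)
    also have "\<dots> \<le> norm (X m - X n) * B + A * norm (Y m - Y n)"
      using A B by (intro add_mono mult_mono) auto
    also have "\<dots> < e / (2 * B) * B + A * (e / (2 * A))"
      using A B M N that by (intro add_strict_mono mult_strict_right_mono mult_strict_left_mono) auto
    also have "\<dots> = e" using A(1) B(1) by simp
    finally show ?thesis .
  qed
  then show "\<exists>M. \<forall>m\<ge>M. \<forall>n\<ge>M. norm (cinner (X m) (Y m) - cinner (X n) (Y n)) < e" by blast
qed

lemma tendsto_cinner_lim:
  fixes X Y :: "nat \<Rightarrow> 'a::complex_inner"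
  shows "Cauchy X \<Longrightarrow> Cauchy Y \<Longrightarrow> (\<lambda>n. cinner (X n) (Y n)) \<longlonglongrightarrow> lim (\<lambda>n. cinner (X n) (Y n))"
  using Cauchy_cinner[of X Y] by (simp add: Cauchy_convergent_iff convergent_LIMSEQ_iff)

lemma cauchy_eq_cinner:
  assumes "cauchy_eq X X'" "cauchy_eq Y Y'"
  shows "lim (\<lambda>n. cinner (X n) (Y n)) = lim (\<lambda>n. cinner (X' n) (Y' n))"
proof -
  have C: "Cauchy X" "Cauchy X'" "Cauchy Y" "Cauchy Y'"
    and Z: "(\<lambda>n. X n - X' n) \<longlonglongrightarrow> 0" "(\<lambda>n. Y n - Y' n) \<longlonglongrightarrow> 0"
    using assms by (auto simp: cauchy_eq_def)
  interpret bounded_bilinear "cinner :: 'a \<Rightarrow> 'a \<Rightarrow> complex" by (rule bounded_bilinear_cinner)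
  have "(\<lambda>n. cinner (X n - X' n) (Y n) + cinner (X' n) (Y n - Y' n)) \<longlonglongrightarrow> 0 + 0"
  proof (rule tendsto_add)
    show "(\<lambda>n. cinner (X n - X' n) (Y n)) \<longlonglongrightarrow> 0"
      using Zfun_prod_Bfun[of "\<lambda>n. X n - X' n" sequentially Y] Z(1) Cauchy_Bseq[OF C(3)]
      by (simp add: tendsto_Zfun_iff)
    show "(\<lambda>n. cinner (X' n) (Y n - Y' n)) \<longlonglongrightarrow> 0"
      using Bfun_prod_Zfun[of X' sequentially "\<lambda>n. Y n - Y' n"] Z(2) Cauchy_Bseq[OF C(2)]
      by (simp add: tendsto_Zfun_iff)
  qed
  then have "(\<lambda>n. cinner (X n) (Y n) - cinner (X' n) (Y' n)) \<longlonglongrightarrow> 0"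
    by (simp add: cinner_simps)
  moreover have "(\<lambda>n. cinner (X n) (Y n) - cinner (X' n) (Y' n))
      \<longlonglongrightarrow> lim (\<lambda>n. cinner (X n) (Y n)) - lim (\<lambda>n. cinner (X' n) (Y' n))"
    using C by (intro tendsto_diff tendsto_cinner_lim)
  ultimately show ?thesis
    using LIMSEQ_unique by fastforce
qed

instantiation completion :: (complex_inner) cinner_space
begin

lift_definition zero_completion :: "'a completion" is "\<lambda>_. 0"
  by (simp add: cauchy_eq_refl convergent_Cauchy convergent_const)

lift_definition plus_completion :: "'a completion \<Rightarrow> 'a completion \<Rightarrow> 'a completion"
  is "\<lambda>X Y n. X n + Y n"
  unfolding cauchy_eq_def by (auto intro: Cauchy_plus dest: tendsto_add simp: add_diff_add)

lift_definition scaleC_completion :: "complex \<Rightarrow> 'a completion \<Rightarrow> 'a completion"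
  is "\<lambda>a X n. a *\<^sub>C X n"
proof -
  fix a :: complex and X Y :: "nat \<Rightarrow> 'a"
  interpret bounded_linear "\<lambda>x::'a. a *\<^sub>C x" by (rule bounded_linear_scaleC)
  assume "cauchy_eq X Y"
  then show "cauchy_eq (\<lambda>n. a *\<^sub>C X n) (\<lambda>n. a *\<^sub>C Y n)"
    unfolding cauchy_eq_def using tendsto_zero[of "\<lambda>n. X n - Y n"] by (auto simp: diff Cauchy)
qed

lift_definition cinner_completion :: "'a completion \<Rightarrow> 'a completion \<Rightarrow> complex"
  is "\<lambda>X Y. lim (\<lambda>n. cinner (X n) (Y n))"
  by (rule cauchy_eq_cinner)

definition "uminus_completion (x :: 'a completion) = (- 1) *\<^sub>C x"
definition "minus_completion (x :: 'a completion) y = x + - y"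

lemma completion_cases:
  obtains X where "Cauchy X" "x = abs_completion X"
  by (metis Quotient_completion Quotient_abs_rep Quotient_rep_reflp cauchy_eq_refl)

lemma completion_eqI: "cauchy_eq X Y \<Longrightarrow> abs_completion X = abs_completion Y"
  using Quotient_completion Quotient_rel_abs by fastforce

lemma completion_abs:
  assumes "Cauchy X"
  shows "a *\<^sub>C abs_completion X = abs_completion (\<lambda>n. a *\<^sub>C X n)"
    and "Cauchy Y \<Longrightarrow> abs_completion X + abs_completion Y = abs_completion (\<lambda>n. X n + Y n)"
    and "Cauchy Y \<Longrightarrow> cinner (abs_completion X) (abs_completion Y) = lim (\<lambda>n. cinner (X n) (Y n))"
  using assms by (simp_all add: scaleC_completion.abs_eq plus_completion.abs_eq
      cinner_completion.abs_eq cauchy_eq_refl)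

lemma Cauchy_scaleC: "Cauchy X \<Longrightarrow> Cauchy (\<lambda>n. a *\<^sub>C (X n :: 'a))"
  by (rule bounded_linear.Cauchy[OF bounded_linear_scaleC])

instance
proof
  fix x y z :: "'a completion" and a b :: complex
  obtain X where X: "Cauchy X" "x = abs_completion X" by (rule completion_cases)
  obtain Y where Y: "Cauchy Y" "y = abs_completion Y" by (rule completion_cases)
  obtain Z where Z: "Cauchy Z" "z = abs_completion Z" by (rule completion_cases)
  note [simp] = X Y Z completion_abs Cauchy_plus Cauchy_scaleC
  have XY: "(\<lambda>n. cinner (X n) (Y n)) \<longlonglongrightarrow> cinner x y"
    and XZ: "(\<lambda>n. cinner (X n) (Z n)) \<longlonglongrightarrow> cinner x z"
    and YX: "(\<lambda>n. cinner (Y n) (X n)) \<longlonglongrightarrow> cinner y x"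
    and XX: "(\<lambda>n. cinner (X n) (X n)) \<longlonglongrightarrow> cinner x x"
    by (auto intro: tendsto_cinner_lim)
  show "x + y + z = x + (y + z)" by (simp add: add.assoc)
  show "x + y = y + x" by (simp add: add.commute)
  show zero: "0 + x = x"
    using plus_completion.abs_eq[of "\<lambda>_. 0" X]
    by (simp add: zero_completion_def cauchy_eq_refl convergent_Cauchy convergent_const)
  show "- x + x = 0"
    unfolding uminus_completion_def zero_completion_def X(2) completion_abs(1)[OF X(1)]
    by (subst completion_abs(2)) (use Cauchy_scaleC[OF X(1), of "- 1"] in
        \<open>simp_all add: X(1) complex_vector.scale_minus_left scaleC_one\<close>)
  show "x - y = x + - y" by (simp add: minus_completion_def)
  show "a *\<^sub>C (x + y) = a *\<^sub>C x + a *\<^sub>C y" by (simp add: scaleC_add_right)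
  show "(a + b) *\<^sub>C x = a *\<^sub>C x + b *\<^sub>C x" by (simp add: scaleC_add_left)
  show "a *\<^sub>C b *\<^sub>C x = (a * b) *\<^sub>C x" by (simp add: scaleC_scaleC)
  show "1 *\<^sub>C x = x" by (simp add: scaleC_one)
  show "cinner x y = cnj (cinner y x)"
  proof (rule LIMSEQ_unique[OF XY])
    show "(\<lambda>n. cinner (X n) (Y n)) \<longlonglongrightarrow> cnj (cinner y x)"
      by (subst cinner_commute) (intro tendsto_cnj YX)
  qed
  show "cinner x (y + z) = cinner x y + cinner x z"
  proof (rule LIMSEQ_unique)
    show "(\<lambda>n. cinner (X n) (Y n + Z n)) \<longlonglongrightarrow> cinner x (y + z)"
      by (simp add: tendsto_cinner_lim)
    show "(\<lambda>n. cinner (X n) (Y n + Z n)) \<longlonglongrightarrow> cinner x y + cinner x z"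
      unfolding cinner_add_right by (intro tendsto_add XY XZ)
  qed
  show "cinner x (a *\<^sub>C y) = a * cinner x y"
  proof (rule LIMSEQ_unique)
    show "(\<lambda>n. cinner (X n) (a *\<^sub>C Y n)) \<longlonglongrightarrow> cinner x (a *\<^sub>C y)"
      by (simp add: tendsto_cinner_lim)
    show "(\<lambda>n. cinner (X n) (a *\<^sub>C Y n)) \<longlonglongrightarrow> a * cinner x y"
      unfolding cinner_scaleC_right by (intro tendsto_mult_left XY)
  qed
  show "0 \<le> Re (cinner x x)"
    using tendsto_Re[OF XX] by (rule LIMSEQ_le_const) (auto simp: cinner_ge_zero)
  show "x = 0" if "cinner x x = 0"
  proof -
    have "(\<lambda>n. cmod (cinner (X n) (X n))) \<longlonglongrightarrow> 0"
      using tendsto_norm[OF XX] that by simp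
    then have "(\<lambda>n. sqrt ((norm (X n))\<^sup>2)) \<longlonglongrightarrow> sqrt 0"
      by (intro tendsto_real_sqrt) (simp add: cinner_norm_sq norm_power)
    then have "X \<longlonglongrightarrow> 0"
      by (simp add: tendsto_norm_zero_iff)
    then show ?thesis
      by (auto intro!: completion_eqI
          simp: zero_completion_def cauchy_eq_def convergent_Cauchy convergent_const)
  qed
qed

end

instantiation completion :: (complex_inner) complex_inner
begin

definition "scaleR_completion r (x :: 'a completion) = complex_of_real r *\<^sub>C x"
definition "norm_completion (x :: 'a completion) = sqrt (Re (cinner x x))"
definition "sgn_completion (x :: 'a completion) = inverse (norm x) *\<^sub>R x"
definition "dist_completion (x :: 'a completion) y = norm (x - y)"
definition "uniformity_completion =
  (INF e\<in>{0 <..}. principal {(x :: 'a completion, y). dist x y < e})"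
definition "open_completion (S :: 'a completion set) =
  (\<forall>x\<in>S. \<forall>\<^sub>F (x', y) in uniformity. x' = x \<longrightarrow> y \<in> S)"

instance
proof
  fix x y :: "'a completion" and a b :: real
  show "a *\<^sub>R (x + y) = a *\<^sub>R x + a *\<^sub>R y" "(a + b) *\<^sub>R x = a *\<^sub>R x + b *\<^sub>R x"
    "a *\<^sub>R b *\<^sub>R x = (a * b) *\<^sub>R x" "1 *\<^sub>R x = x" "a *\<^sub>R x = complex_of_real a *\<^sub>C x"
    by (auto simp: scaleR_completion_def scaleC_add_right scaleC_add_left scaleC_scaleC scaleC_one)
  show "norm x = 0 \<longleftrightarrow> x = 0"
    using cinner_self[of x] cinner_eq_zero[of x] by (auto simp: norm_completion_def)
  show "norm (x + y) \<le> norm x + norm y"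
    unfolding norm_completion_def by (rule sqrt_cinner_triangle)
  show "norm (a *\<^sub>R x) = \<bar>a\<bar> * norm x"
    by (simp add: norm_completion_def scaleR_completion_def sqrt_cinner_scaleC)
qed (simp_all add: sgn_completion_def dist_completion_def uniformity_completion_def
    open_completion_def norm_completion_def)

end

definition completion_of :: "'a::complex_inner \<Rightarrow> 'a completion" where
  "completion_of x = abs_completion (\<lambda>_. x)"

lemma Cauchy_const [simp]: "Cauchy (\<lambda>_::nat. x :: 'a::real_normed_vector)"
  by (simp add: convergent_Cauchy convergent_const)

lemma completion_of_add: "completion_of (x + y) = completion_of x + completion_of y"
  by (simp add: completion_of_def completion_abs)

lemma completion_of_scaleC: "completion_of (a *\<^sub>C x) = a *\<^sub>C completion_of x"
  by (simp add: completion_of_def completion_abs)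

lemma completion_of_cinner: "cinner (completion_of x) (completion_of y) = cinner x y"
  by (simp add: completion_of_def completion_abs)

lemma completion_of_diff: "completion_of (x - y) = completion_of x - completion_of y"
  using completion_of_add[of "x - y" y] by (simp add: algebra_simps)

lemma completion_of_norm: "norm (completion_of x) = norm x"
  by (simp add: norm_eq_sqrt_cinner completion_of_cinner)

lemma completion_of_tendsto:
  assumes "Cauchy X"
  shows "(\<lambda>n. completion_of (X n)) \<longlonglongrightarrow> abs_completion X"
proof (rule LIMSEQ_I)
  fix e :: real
  assume e: "0 < e"
  then obtain M where M: "\<And>m n. m \<ge> M \<Longrightarrow> n \<ge> M \<Longrightarrow> norm (X m - X n) < e / 2"
    using CauchyD[OF assms, of "e / 2"] by auto
  have "norm (completion_of (X n) - abs_completion X) < e" if n: "n \<ge> M" for n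
  proof -
    define Y where "Y = (\<lambda>m. X n + (- 1) *\<^sub>C X m)"
    have Y: "Cauchy Y" unfolding Y_def
      by (intro Cauchy_plus Cauchy_const Cauchy_scaleC assms)
    have m1: "(- 1) *\<^sub>C y = - y" for y :: "'b::cinner_space"
      by (simp add: complex_vector.scale_minus_left scaleC_one)
    have "completion_of (X n) - abs_completion X
        = abs_completion (\<lambda>_. X n) + (- 1) *\<^sub>C abs_completion X"
      by (simp add: completion_of_def m1)
    also have "\<dots> = abs_completion Y"
      unfolding Y_def completion_abs(1)[OF assms]
      by (rule completion_abs(2)) (intro Cauchy_const Cauchy_scaleC assms)+
    finally have eq: "completion_of (X n) - abs_completion X = abs_completion Y" .
    have "(\<lambda>m. sqrt (Re (cinner (Y m) (Y m)))) \<longlonglongrightarrow> sqrt (Re (cinner (abs_completion Y) (abs_completion Y)))"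
      using Y by (intro tendsto_real_sqrt tendsto_Re) (simp add: completion_abs tendsto_cinner_lim)
    then have "(\<lambda>m. norm (Y m)) \<longlonglongrightarrow> norm (abs_completion Y)"
      by (simp add: norm_eq_sqrt_cinner)
    then have "norm (abs_completion Y) \<le> e / 2"
      by (rule LIMSEQ_le_const2) (use M n in \<open>force simp: Y_def m1 intro!: exI[of _ M] less_imp_le\<close>)
    then show ?thesis using e by (simp add: eq)
  qed
  then show "\<exists>M. \<forall>n\<ge>M. norm (completion_of (X n) - abs_completion X) < e" by blast
qed

instance completion :: (complex_inner) chilbert_space
proof
  fix Z :: "nat \<Rightarrow> 'a completion"
  assume Z: "Cauchy Z"
  have "\<exists>x. norm (completion_of x - Z n) < 1 / Suc n" for n
  proof -
    obtain X where "Cauchy X" "Z n = abs_completion X" by (rule completion_cases)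
    then show ?thesis
      using LIMSEQ_D[OF completion_of_tendsto, of X "1 / Suc n"] by auto
  qed
  then obtain x where x: "\<And>n. norm (completion_of (x n) - Z n) < 1 / Suc n" by metis
  have "(\<lambda>n. norm (completion_of (x n) - Z n)) \<longlonglongrightarrow> 0"
    by (rule tendsto_sandwich[OF _ _ tendsto_const LIMSEQ_Suc[OF lim_1_over_n]])
      (use x less_imp_le in \<open>auto intro!: always_eventually\<close>)
  then have D: "(\<lambda>n. completion_of (x n) - Z n) \<longlonglongrightarrow> 0"
    by (simp add: tendsto_norm_zero_iff)
  have "Cauchy (\<lambda>n. (completion_of (x n) - Z n) + Z n)"
    by (rule Cauchy_plus[OF _ Z]) (use D in \<open>auto intro: convergent_Cauchy convergentI\<close>)
  then have "Cauchy (\<lambda>n. completion_of (x n))" by simp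
  then have "Cauchy x"
    by (simp add: Cauchy_iff completion_of_norm flip: completion_of_diff)
  then have "(\<lambda>n. completion_of (x n) - (completion_of (x n) - Z n)) \<longlonglongrightarrow> abs_completion x - 0"
    by (intro tendsto_diff completion_of_tendsto D)
  then show "convergent Z" by (auto intro: convergentI)
qed

section \<open>The Hilbert space tensor product\<close>

text \<open>Tensor products associate to the left, on types as well as on vectors.\<close>

type_synonym ('a, 'b) htensor = "('a, 'b) alg_tensor completion" (infixl "\<otimes>\<^sub>H" 70)

lift_definition alg_tensor_elem ::
  "'a::complex_inner \<Rightarrow> 'b::complex_inner \<Rightarrow> ('a, 'b) alg_tensor" is "\<lambda>x y. [(1, x, y)]" .

definition tensor :: "'a::complex_inner \<Rightarrow> 'b::complex_inner \<Rightarrow> 'a \<otimes>\<^sub>H 'b" (infixl "\<otimes>" 70) where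
  "x \<otimes> y = completion_of (alg_tensor_elem x y)"

text \<open>The operator \<open>I \<otimes> I \<otimes> (g|\<close>. By \<open>bra3_unique_existence\<close> below there is exactly one map
  with the property in the description.\<close>

definition bra3 :: "'c::chilbert_space \<Rightarrow> 'a::chilbert_space \<otimes>\<^sub>H 'b::chilbert_space \<otimes>\<^sub>H 'c \<Rightarrow> 'a \<otimes>\<^sub>H 'b" where
  "bra3 g = (THE L. bounded_clinear L \<and> (\<forall>x y z. L (x \<otimes> y \<otimes> z) = cinner g z *\<^sub>C (x \<otimes> y)))"

text \<open>\<open>A \<otimes> B \<otimes> M\<close> for a subspace \<open>M\<close> of the third factor, as a closed subspace of the full
  tensor product.\<close>

definition tensor3_subspace :: "'c::chilbert_space set \<Rightarrow> ('a::chilbert_space \<otimes>\<^sub>H 'b::chilbert_space \<otimes>\<^sub>H 'c) set" where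
  "tensor3_subspace M = closure (cspan {x \<otimes> y \<otimes> z | x y z. z \<in> M})"

lemma cinner_tensor: "cinner (x \<otimes> y) (x' \<otimes> y') = cinner x x' * cinner y y'"
  unfolding tensor_def completion_of_cinner by transfer (simp add: fs_inner_single)

lemma norm_tensor: "norm (x \<otimes> y) = norm x * norm y"
proof -
  have "complex_of_real ((norm (x \<otimes> y))\<^sup>2) = of_real ((norm x * norm y)\<^sup>2)"
    using cinner_tensor[of x y x y] by (simp add: cinner_norm_sq power_mult_distrib)
  then show ?thesis
    by (metis mult_nonneg_nonneg norm_ge_zero of_real_eq_iff power2_eq_iff_nonneg)
qed

lemma tensor_add_left: "(x + x') \<otimes> y = x \<otimes> y + x' \<otimes> y"
  unfolding tensor_def completion_of_add[symmetric]
  by (rule arg_cong[of _ _ completion_of], transfer)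
    (simp add: fs_inner_def cinner_simps algebra_simps sum_list_addf[symmetric] case_prod_unfold)

lemma tensor_add_right: "x \<otimes> (y + y') = x \<otimes> y + x \<otimes> y'"
  unfolding tensor_def completion_of_add[symmetric]
  by (rule arg_cong[of _ _ completion_of], transfer)
    (simp add: fs_inner_def cinner_simps algebra_simps sum_list_addf[symmetric] case_prod_unfold)

lemma tensor_scaleC_left: "(a *\<^sub>C x) \<otimes> y = a *\<^sub>C (x \<otimes> y)"
  unfolding tensor_def completion_of_scaleC[symmetric]
  by (rule arg_cong[of _ _ completion_of], transfer)
    (simp add: fs_inner_def fs_scale_def cinner_simps algebra_simps)

lemma tensor_scaleC_right: "x \<otimes> (a *\<^sub>C y) = a *\<^sub>C (x \<otimes> y)"
  unfolding tensor_def completion_of_scaleC[symmetric]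
  by (rule arg_cong[of _ _ completion_of], transfer)
    (simp add: fs_inner_def fs_scale_def cinner_simps algebra_simps)

lemma alg_tensor_induct:
  assumes "P 0" "\<And>x y t. P t \<Longrightarrow> P (alg_tensor_elem x y + t)"
  shows "P (t :: ('a::complex_inner, 'b::complex_inner) alg_tensor)"
proof -
  have "P (abs_alg_tensor F)" for F
  proof (induction F)
    case Nil
    then show ?case using assms(1) by (simp add: zero_alg_tensor_def)
  next
    case (Cons s F)
    obtain c a b where s: "s = (c, a, b)" by (cases s)
    have "alg_tensor_elem (c *\<^sub>C a) b + abs_alg_tensor F = abs_alg_tensor ((1, c *\<^sub>C a, b) # F)"
      by (simp add: alg_tensor_elem_def plus_alg_tensor.abs_eq)
    also have "\<dots> = abs_alg_tensor (s # F)"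
      unfolding s alg_tensor.abs_eq_iff
      by (simp add: fs_inner_def cinner_simps algebra_simps)
    finally show ?case using assms(2)[OF Cons] by metis
  qed
  then show ?thesis by (metis alg_tensor.abs_induct)
qed

lemma htensor_induct:
  fixes t :: "'a::complex_inner \<otimes>\<^sub>H 'b::complex_inner"
  assumes "closed {t. P t}" "P 0" "\<And>x y t. P t \<Longrightarrow> P (x \<otimes> y + t)"
  shows "P t"
proof -
  have alg: "P (completion_of s)" for s :: "('a, 'b) alg_tensor"
    using assms(2,3) completion_of_scaleC[of 0 s]
    by (induction s rule: alg_tensor_induct)
      (auto simp: completion_of_add simp flip: tensor_def completion_of_diff[of 0 0, simplified])
  obtain X where X: "Cauchy X" "t = abs_completion X" by (rule completion_cases)
  have "t \<in> {t. P t}"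
    using assms(1) by (rule closed_sequentially) (use X completion_of_tendsto alg in auto)
  then show ?thesis by simp
qed

lemma htensor_eqI:
  fixes L L' :: "'a::complex_inner \<otimes>\<^sub>H 'b::complex_inner \<Rightarrow> 'c::real_normed_vector"
  assumes "bounded_linear L" "bounded_linear L'" "\<And>x y. L (x \<otimes> y) = L' (x \<otimes> y)"
  shows "L = L'"
proof
  fix t
  interpret L: bounded_linear L by fact
  interpret L': bounded_linear L' by fact
  show "L t = L' t"
  proof (rule htensor_induct[where P = "\<lambda>t. L t = L' t"])
    show "closed {t. L t = L' t}"
      by (intro closed_Collect_eq L.continuous_on L'.continuous_on continuous_on_id)
  qed (auto simp: L.add L'.add L.zero L'.zero assms(3))
qed

lemma bounded_linear_tensor_left: "bounded_linear (\<lambda>x. x \<otimes> y)"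
  by (rule bounded_linear_intro[of _ "norm y"])
    (auto simp: tensor_add_left tensor_scaleC_left scaleR_scaleC norm_tensor)

lemma fs_contract2_cong:
  assumes "\<forall>K. fs_inner K F = fs_inner K G"
  shows "fs_contract2 y F = fs_contract2 y G"
proof -
  define d where "d = fs_contract2 y F - fs_contract2 y G"
  have "cinner d d = 0"
    using assms by (subst (2) d_def) (simp add: cinner_diff_right fs_contract2_inner)
  then show ?thesis
    using cinner_eq_zero d_def by fastforce
qed

lift_definition alg_contract2 ::
  "'b::complex_inner \<Rightarrow> ('a::complex_inner, 'b) alg_tensor \<Rightarrow> 'a" is fs_contract2
  using fs_contract2_cong by blast

lemma bra3_existence:
  fixes g :: "'c::chilbert_space"
  shows "\<exists>L :: 'a::chilbert_space \<otimes>\<^sub>H 'c \<Rightarrow> 'a. bounded_clinear L \<and> (\<forall>x z. L (x \<otimes> z) = cinner g z *\<^sub>C x)"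
proof -
  define f :: "('a, 'c) alg_tensor \<Rightarrow> 'a" where "f = alg_contract2 g"
  have f_norm: "norm (f s) \<le> norm g * norm s" for s
    unfolding f_def norm_alg_tensor_def by transfer (rule fs_contract2_norm)
  have f_add: "f (s + t) = f s + f t" for s t
    unfolding f_def by transfer (simp add: fs_contract2_def)
  have f_scale: "f (a *\<^sub>C s) = a *\<^sub>C f s" for a s
    unfolding f_def
  proof (transfer)
    fix g :: 'c and a and F :: "(complex \<times> 'a \<times> 'c) list"
    show "fs_contract2 g (fs_scale a F) = a *\<^sub>C fs_contract2 g F"
      by (induction F) (auto simp: fs_contract2_def fs_scale_def scaleC_add_right scaleC_scaleC
          complex_vector.scale_zero_right mult.assoc)
  qed
  have f_elem: "f (alg_tensor_elem x z) = cinner g z *\<^sub>C x" for x z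
    unfolding f_def by transfer (simp add: fs_contract2_def)
  have "bounded_linear f"
    by (rule bounded_linear_intro[of _ "norm g"])
      (auto simp: f_add f_scale f_norm scaleR_scaleC mult.commute)
  then interpret f: bounded_linear f .
  define L where "L t = lim (\<lambda>n. f (rep_completion t n))" for t
  have L: "(\<lambda>n. f (X n)) \<longlonglongrightarrow> L (abs_completion X)" if "Cauchy X" for X
  proof -
    define Y where "Y = rep_completion (abs_completion X)"
    have "cauchy_eq Y X"
      using that unfolding Y_def
      by (metis Quotient_completion Quotient_rep_abs cauchy_eq_refl)
    then have Y: "Cauchy Y" "(\<lambda>n. Y n - X n) \<longlonglongrightarrow> 0" by (auto simp: cauchy_eq_def)
    have "(\<lambda>n. f (Y n)) \<longlonglongrightarrow> L (abs_completion X)"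
      using f.Cauchy[OF Y(1)]
      by (simp add: L_def Cauchy_convergent_iff convergent_LIMSEQ_iff flip: Y_def)
    then have "(\<lambda>n. f (Y n) - f (Y n - X n)) \<longlonglongrightarrow> L (abs_completion X) - 0"
      by (intro tendsto_diff f.tendsto_zero Y)
    then show ?thesis by (simp add: f.diff)
  qed
  have "bounded_clinear L"
    unfolding bounded_clinear_def
  proof (intro conjI clinearI exI allI)
    fix s t :: "'a \<otimes>\<^sub>H 'c" and a
    obtain X where X: "Cauchy X" "s = abs_completion X" by (rule completion_cases)
    obtain Y where Y: "Cauchy Y" "t = abs_completion Y" by (rule completion_cases)
    show "L (s + t) = L s + L t"
    proof (rule LIMSEQ_unique)
      show "(\<lambda>n. f (X n + Y n)) \<longlonglongrightarrow> L (s + t)"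
        using L[OF Cauchy_plus[OF X(1) Y(1)]] by (simp add: X Y completion_abs)
      show "(\<lambda>n. f (X n + Y n)) \<longlonglongrightarrow> L s + L t"
        using tendsto_add[OF L[OF X(1)] L[OF Y(1)]] by (simp add: X Y f_add)
    qed
    show "L (a *\<^sub>C s) = a *\<^sub>C L s"
    proof (rule LIMSEQ_unique)
      show "(\<lambda>n. f (a *\<^sub>C X n)) \<longlonglongrightarrow> L (a *\<^sub>C s)"
        using L[OF Cauchy_scaleC[OF X(1)]] by (simp add: X completion_abs)
      show "(\<lambda>n. f (a *\<^sub>C X n)) \<longlonglongrightarrow> a *\<^sub>C L s"
        using bounded_linear.tendsto[OF bounded_linear_scaleC L[OF X(1)]] by (simp add: X f_scale)
    qed
    show "norm (L s) \<le> norm g * norm s"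
    proof (rule LIMSEQ_le)
      show "(\<lambda>n. norm (f (X n))) \<longlonglongrightarrow> norm (L s)"
        using tendsto_norm[OF L[OF X(1)]] by (simp add: X)
      show "(\<lambda>n. norm g * norm (X n)) \<longlonglongrightarrow> norm g * norm s"
        using tendsto_mult_left[OF tendsto_norm[OF completion_of_tendsto[OF X(1)]]]
        by (simp add: X completion_of_norm)
    qed (use f_norm in auto)
  qed
  moreover have "L (x \<otimes> z) = cinner g z *\<^sub>C x" for x z
    using L[of "\<lambda>_. alg_tensor_elem x z"]
    by (simp add: f_elem tensor_def completion_of_def LIMSEQ_const_iff)
  ultimately show ?thesis by blast
qed

lemma bra3_unique_existence:
  "\<exists>!L. bounded_clinear L \<and>
    (\<forall>x y z. L ((x :: 'a::chilbert_space) \<otimes> (y :: 'b::chilbert_space) \<otimes> z)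
      = cinner (g :: 'c::chilbert_space) z *\<^sub>C (x \<otimes> y))"
proof (rule ex_ex1I)
  show "\<exists>L. bounded_clinear L \<and>
    (\<forall>x y z. L ((x :: 'a) \<otimes> (y :: 'b) \<otimes> z) = cinner g z *\<^sub>C (x \<otimes> y))"
    using bra3_existence[of g, where 'a = "'a \<otimes>\<^sub>H 'b"] by blast
next
  fix L L' :: "'a \<otimes>\<^sub>H 'b \<otimes>\<^sub>H 'c \<Rightarrow> 'a \<otimes>\<^sub>H 'b"
  assume L: "bounded_clinear L \<and> (\<forall>x y z. L (x \<otimes> y \<otimes> z) = cinner g z *\<^sub>C (x \<otimes> y))"
    and L': "bounded_clinear L' \<and> (\<forall>x y z. L' (x \<otimes> y \<otimes> z) = cinner g z *\<^sub>C (x \<otimes> y))"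
  have bl: "bounded_linear L" "bounded_linear L'"
    using L L' bounded_clinear_bounded_linear by auto
  show "L = L'"
  proof (rule htensor_eqI[OF bl])
    fix t z
    have "(\<lambda>t. L (t \<otimes> z)) = (\<lambda>t. L' (t \<otimes> z))"
      by (rule htensor_eqI)
        (use L L' in \<open>auto intro!: bounded_linear_compose[OF bl(1)] bounded_linear_compose[OF bl(2)]
          bounded_linear_tensor_left\<close>)
    then show "L (t \<otimes> z) = L' (t \<otimes> z)" by metis
  qed
qed

lemma bra3:
  shows bra3_bounded_clinear: "bounded_clinear (bra3 g)"
    and bra3_tensor: "bra3 g (x \<otimes> y \<otimes> z) = cinner g z *\<^sub>C (x \<otimes> y)"
  using theI'[OF bra3_unique_existence[of g]] unfolding bra3_def[symmetric] by auto

end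

theory Submission
  imports Defs
begin

text \<open>The map \<open>\<phi> \<mapsto> (g|\<^sub>C U (\<phi> \<otimes> e \<otimes> f)\<close> is linear. For \<open>x\<close> and \<open>y\<close> nonzero and orthogonal, the
  image of \<open>x + y\<close> is the sum of multiples of \<open>x \<otimes> x\<close> and \<open>y \<otimes> y\<close>, so it is orthogonal to \<open>x \<otimes> y\<close>,
  whereas a nonzero multiple of \<open>(x + y) \<otimes> (x + y)\<close> is not.\<close>

text \<open>One Gram-Schmidt step on the two elements of \<open>B\<close>. Normalization is left
  out, since the later argument only needs nonzero vectors.\<close>

lemma exists_nonzero_orthogonal_pair:
  fixes B :: "'a::cinner_space set"
  assumes "\<not> cdependent B" "card B = 2"
  obtains x y :: 'a where "x \<noteq> 0" "y \<noteq> 0" "cinner x y = 0"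
proof -
  obtain x z where B: "B = {x, z}" "x \<noteq> z"
    using assms(2) by (meson card_2_iff)
  have x: "x \<noteq> 0"
    using assms(1) B complex_vector.dependent_zero by blast
  have xx: "cinner x x \<noteq> 0"
    using x cinner_eq_zero by blast
  \<comment> \<open>\<open>k *\<^sub>C x\<close> is the orthogonal projection of \<open>z\<close>
    onto the line through \<open>x\<close>. The remainder cannot vanish, as \<open>z\<close> would
    then lie in the span of \<open>B - {z}\<close>.\<close>
  define k where "k = cinner x z / cinner x x"
  have "z \<noteq> k *\<^sub>C x"
  proof
    assume "z = k *\<^sub>C x"
    then have "z \<in> cspan (B - {z})"
      using B by (simp add: complex_vector.span_base complex_vector.span_scale)
    then show False
      using assms(1) B unfolding complex_vector.dependent_def by blast
  qed
  moreover have "cinner x (z - k *\<^sub>C x) = 0"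
    using xx by (simp add: cinner_simps k_def)
  ultimately show thesis
    using that[of x "z - k *\<^sub>C x"] x by simp
qed

text \<open>Rescaling extends the unit-vector hypothesis to all nonzero vectors, so that it can be
  used for a sum such as \<open>x + y\<close>, which need not be normalized.\<close>

lemma clinear_maps_to_squares:
  fixes L :: "'a::complex_inner \<Rightarrow> 'a \<otimes>\<^sub>H 'a"
  assumes L: "clinear L"
    and sq: "\<And>\<phi>. norm \<phi> = 1 \<Longrightarrow> \<exists>c. c \<noteq> 0 \<and> L \<phi> = c *\<^sub>C (\<phi> \<otimes> \<phi>)"
    and "\<phi> \<noteq> 0"
  shows "\<exists>c. c \<noteq> 0 \<and> L \<phi> = c *\<^sub>C (\<phi> \<otimes> \<phi>)"
proof -
  define r where "r = complex_of_real (norm \<phi>)"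
  define u where "u = inverse r *\<^sub>C \<phi>"
  have r: "r \<noteq> 0"
    using \<open>\<phi> \<noteq> 0\<close> by (simp add: r_def)
  have "norm u = 1"
    using \<open>\<phi> \<noteq> 0\<close> by (simp add: u_def r_def norm_scaleC norm_inverse)
  then obtain c where c: "c \<noteq> 0" "L u = c *\<^sub>C (u \<otimes> u)"
    using sq by blast
  have "\<phi> = r *\<^sub>C u"
    using r by (simp add: u_def scaleC_scaleC scaleC_one)
  then have "L \<phi> = r *\<^sub>C L u"
    by (simp add: clinearD(2)[OF L])
  \<comment> \<open>One factor \<open>r\<close> comes from linearity of \<open>L\<close>, and one
    \<open>inverse r\<close> from each of the two tensor factors.\<close>
  also have "\<dots> = (r * c * inverse r * inverse r) *\<^sub>C (\<phi> \<otimes> \<phi>)"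
    unfolding c(2) by (simp add: u_def tensor_scaleC_left tensor_scaleC_right scaleC_scaleC mult.assoc)
  finally show ?thesis
    using c(1) r by (metis mult_eq_0_iff inverse_nonzero_iff_nonzero)
qed

lemma no_clinear_squaring:
  fixes L :: "'a::complex_inner \<Rightarrow> 'a \<otimes>\<^sub>H 'a" and B :: "'a set"
  assumes L: "clinear L"
    and sq: "\<And>\<phi>. norm \<phi> = 1 \<Longrightarrow> \<exists>c. c \<noteq> 0 \<and> L \<phi> = c *\<^sub>C (\<phi> \<otimes> \<phi>)"
    and B: "\<not> cdependent B" "card B = 2"
  shows False
proof -
  obtain x y :: 'a where xy: "x \<noteq> 0" "y \<noteq> 0" "cinner x y = 0"
    using exists_nonzero_orthogonal_pair[OF B] .
  have yx: "cinner y x = 0"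
    using xy(3) cinner_commute[of y x] by simp
  have pos: "cinner x x \<noteq> 0" "cinner y y \<noteq> 0"
    using xy cinner_eq_zero by blast+
  \<comment> \<open>By orthogonality this inner product equals \<open>cinner x x\<close>.\<close>
  have "cinner x (x + y) \<noteq> 0"
    using pos xy by (simp add: cinner_simps)
  then have "x + y \<noteq> 0" by auto
  then obtain a b c where c: "c \<noteq> 0"
    and eqs: "L x = a *\<^sub>C (x \<otimes> x)" "L y = b *\<^sub>C (y \<otimes> y)" "L (x + y) = c *\<^sub>C ((x + y) \<otimes> (x + y))"
    using clinear_maps_to_squares[OF L sq] xy by metis
  have "c *\<^sub>C ((x + y) \<otimes> (x + y)) = a *\<^sub>C (x \<otimes> x) + b *\<^sub>C (y \<otimes> y)"
    using eqs clinearD(1)[OF L, of x y] by simp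
  \<comment> \<open>Each term on the right contributes a factor \<open>cinner y x\<close> or
    \<open>cinner x y\<close>, hence 0. Expanding the left side instead gives
    \<open>c * cinner x x * cinner y y\<close>, which is nonzero.\<close>
  then have "cinner (x \<otimes> y) (c *\<^sub>C ((x + y) \<otimes> (x + y))) = 0"
    by (simp add: cinner_simps cinner_tensor xy yx)
  then show False
    using c pos by (simp add: cinner_simps cinner_tensor xy yx)
qed

lemma clinear_bra3: "clinear (bra3 g)"
  by (rule bra3_bounded_clinear[unfolded bounded_clinear_def, THEN conjunct1])

lemma clinear_bra3_unitary:
  fixes U :: "'a::chilbert_space \<otimes>\<^sub>H 'b::chilbert_space \<otimes>\<^sub>H 'c::chilbert_space \<Rightarrow> 'a \<otimes>\<^sub>H 'b \<otimes>\<^sub>H 'c"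
  assumes "unitary U"
  shows "clinear (\<lambda>\<phi>. bra3 g (U (\<phi> \<otimes> e \<otimes> f)))"
proof -
  have U: "clinear U"
    using assms by (simp add: unitary_def)
  show ?thesis
    by (rule clinearI) (simp_all add: tensor_add_left tensor_scaleC_left clinearD[OF U] clinearD[OF clinear_bra3])
qed

text \<open>\<open>bra3 g\<close> kills the generators because \<open>cinner g z = 0\<close>, hence
  their span by linearity, and hence the closure because the kernel of a bounded map is
  closed.\<close>

lemma bra3_orthogonal_eq_0:
  assumes "\<Phi> \<in> tensor3_subspace (orthogonal_complement (cspan {g}))"
  shows "bra3 g \<Phi> = 0"
proof -
  let ?b = "bra3 g :: 'a \<otimes>\<^sub>H 'b \<otimes>\<^sub>H 'c \<Rightarrow> 'a \<otimes>\<^sub>H 'b"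
  let ?S = "{x \<otimes> y \<otimes> z | x y z. z \<in> orthogonal_complement (cspan {g})} :: ('a \<otimes>\<^sub>H 'b \<otimes>\<^sub>H 'c) set"
  interpret b: bounded_linear ?b
    by (rule bounded_clinear_bounded_linear[OF bra3_bounded_clinear])
  have "?b t = 0" if "t \<in> cspan ?S" for t
    using that
  proof (induction rule: complex_vector.span_induct_alt)
    case base
    show ?case by (rule b.zero)
  next
    case (step c s t)
    then obtain x y z where "s = x \<otimes> y \<otimes> z" "z \<in> orthogonal_complement (cspan {g})"
      by blast
    moreover from this have "cinner g z = 0"
      by (simp add: orthogonal_complement_def complex_vector.span_base)
    ultimately show ?case
      using step by (simp add: clinearD[OF clinear_bra3] bra3_tensor)
  qed
  then have "closure (cspan ?S) \<subseteq> {t. ?b t = 0}"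
    by (intro closure_minimal closed_Collect_eq b.continuous_on continuous_intros) auto
  then show ?thesis
    using assms unfolding tensor3_subspace_def by blast
qed

theorem mainTheorem1:
  assumes dim_ge_2: "\<exists>B :: 'h::chilbert_space set. \<not> cdependent B \<and> card B = 2"
  shows
    "\<not> (\<exists>(U :: 'h \<otimes>\<^sub>H 'h \<otimes>\<^sub>H 'c \<Rightarrow> 'h \<otimes>\<^sub>H 'h \<otimes>\<^sub>H 'c) (e :: 'h) (f :: 'c::chilbert_space) (g :: 'c).
        unitary U \<and> norm e = 1 \<and> norm f = 1 \<and> norm g = 1 \<and>
        (\<forall>\<phi>. norm \<phi> = 1 \<longrightarrow>
          (\<exists>c::complex. 0 < cmod c \<and> cmod c \<le> 1 \<and>
            bra3 g (U (\<phi> \<otimes> e \<otimes> f)) = c *\<^sub>C (\<phi> \<otimes> \<phi>))))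
     \<and>
     \<not> (\<exists>(U :: 'h \<otimes>\<^sub>H 'h \<otimes>\<^sub>H 'c \<Rightarrow> 'h \<otimes>\<^sub>H 'h \<otimes>\<^sub>H 'c) (e :: 'h) (f :: 'c) (g :: 'c).
        unitary U \<and> norm e = 1 \<and> norm f = 1 \<and> norm g = 1 \<and>
        (\<forall>\<phi>. norm \<phi> = 1 \<longrightarrow>
          (\<exists>(c::complex) \<Phi>. 0 < cmod c \<and> cmod c \<le> 1 \<and>
            \<Phi> \<in> tensor3_subspace (orthogonal_complement (cspan {g})) \<and>
            U (\<phi> \<otimes> e \<otimes> f) = c *\<^sub>C (\<phi> \<otimes> \<phi> \<otimes> g) + \<Phi>)))"
proof -
  obtain B :: "'h set" where B: "\<not> cdependent B" "card B = 2"
    using dim_ge_2 by blast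
  \<comment> \<open>Both formulations reduce to this claim. The bound \<open>0 < cmod c\<close>
    supplies the nonzero coefficient that \<open>no_clinear_squaring\<close> asks for.\<close>
  have no_cloning: False
    if U: "unitary U"
      and c: "\<And>\<phi>. norm \<phi> = 1 \<Longrightarrow>
        \<exists>c. 0 < cmod c \<and> cmod c \<le> 1 \<and> bra3 g (U (\<phi> \<otimes> e \<otimes> f)) = c *\<^sub>C (\<phi> \<otimes> \<phi>)"
    for U :: "'h \<otimes>\<^sub>H 'h \<otimes>\<^sub>H 'c \<Rightarrow> 'h \<otimes>\<^sub>H 'h \<otimes>\<^sub>H 'c" and e f g
    by (rule no_clinear_squaring[OF clinear_bra3_unitary[OF U, of g e f] _ B]) (use c in force)
  show ?thesis
  proof (rule conjI; rule notI; elim exE conjE)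
    fix U :: "'h \<otimes>\<^sub>H 'h \<otimes>\<^sub>H 'c \<Rightarrow> 'h \<otimes>\<^sub>H 'h \<otimes>\<^sub>H 'c" and e :: 'h and f g :: 'c
    assume "unitary U" and "\<forall>\<phi>. norm \<phi> = 1 \<longrightarrow>
      (\<exists>c. 0 < cmod c \<and> cmod c \<le> 1 \<and> bra3 g (U (\<phi> \<otimes> e \<otimes> f)) = c *\<^sub>C (\<phi> \<otimes> \<phi>))"
    then show False
      using no_cloning by blast
  next
    fix U :: "'h \<otimes>\<^sub>H 'h \<otimes>\<^sub>H 'c \<Rightarrow> 'h \<otimes>\<^sub>H 'h \<otimes>\<^sub>H 'c" and e :: 'h and f g :: 'c
    assume U: "unitary U" and g: "norm g = 1" and c: "\<forall>\<phi>. norm \<phi> = 1 \<longrightarrow>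
      (\<exists>c \<Phi>. 0 < cmod c \<and> cmod c \<le> 1 \<and>
        \<Phi> \<in> tensor3_subspace (orthogonal_complement (cspan {g})) \<and>
        U (\<phi> \<otimes> e \<otimes> f) = c *\<^sub>C (\<phi> \<otimes> \<phi> \<otimes> g) + \<Phi>)"
    \<comment> \<open>Applying \<open>bra3 g\<close> turns the second formulation into the first:
      \<open>\<Phi>\<close> is killed, and \<open>cinner g g = 1\<close> leaves the coefficient
      \<open>c\<close> unchanged.\<close>
    have "bra3 g (c *\<^sub>C (\<phi> \<otimes> \<phi> \<otimes> g) + \<Phi>) = c *\<^sub>C (\<phi> \<otimes> \<phi>)"
      if "\<Phi> \<in> tensor3_subspace (orthogonal_complement (cspan {g}))" for c \<Phi> and \<phi> :: 'h
      using g by (simp add: clinearD[OF clinear_bra3] bra3_tensor bra3_orthogonal_eq_0[OF that]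
          cinner_norm_sq scaleC_one)
    then show False
      using c by (intro no_cloning[OF U, of g e f]) metis
  qed
qed

end
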